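(* Let $\rho\in(0,1)$, let $\widehat F$ be the integrated tail distribution of a nonnegative distribution $F$ with finite positive mean, let $\Pi$ be a nonnegative discrete probability distribution supported on $\{s_i:i\in\mathbb{N}\}$ with $0<s_1<s_2<\cdots$, let $G_m\sim\mathrm{Erlang}(\xi,\xi)$ with $\xi\in\mathbb{N}$, $\xi\ge 1$, and let $u>0$. Put $$\eta:=\sup_{0\le s\le u}\left|\widehat F\star G_m(s)-\Pi\star G_m(s)\right|.$$ Then for all $0<\delta<\infty$ it holds that $$\left|\psi_{\widehat F\star G_m}(u)-\psi_{\Pi\star G_m}(u)\right|\le\frac{\eta(1-\rho)\rho}{\big(1-\rho(\widehat F(u/\delta)+G_m(\delta))\big)\big(1-\rho(\Pi(u/\delta)+G_m(\delta))\big)}.$$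
   Context: The integrated tail of $F$ with mean $\mu_F$ is $\widehat F(u)=\mu_F^{-1}\int_0^u(1-F(t))\,dt$. $\mathrm{Erlang}(\xi,\xi)$ is the Gamma distribution with shape $\xi$ and rate $\xi$. For nonnegative distributions, $H\star G(u)=\int_0^\infty H(u/s)\,dG(s)$ (Mellin--Stieltjes convolution, the law of a product of independent variables). For a distribution $H$ on $[0,\infty)$, $\psi_H(u):=(1-\rho)\sum_{n=1}^\infty\rho^n(1-H^{*n}(u))$, with $H^{*n}$ the $n$-fold additive convolution. Distributions are identified with their cumulative distribution functions.
   Formalization: The bound is proved only for those δ>0 for which both denominator factors, 1−ρ(F̂(u/δ)+G_m(δ)) and 1−ρ(Π(u/δ)+G_m(δ)), are positive; without this the right side can be negative, undefined or too small, and the claim fails. *)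

theory Defs
  imports "HOL-Probability.Probability"
begin

text \<open>
  Distributions on \<open>[0,\<infinity>)\<close> are identified with their cumulative distribution
  functions \<open>H :: real \<Rightarrow> real\<close>; the Stieltjes measure \<open>dH\<close> is
  \<^term>\<open>interval_measure H\<close>.
\<close>

definition nonneg_distribution :: "(real \<Rightarrow> real) \<Rightarrow> bool" where
  "nonneg_distribution H \<longleftrightarrow>
     mono H \<and> (\<forall>a. continuous (at_right a) H) \<and> (H \<longlongrightarrow> 1) at_top \<and> (\<forall>x<0. H x = 0)"

definition dist_mean :: "(real \<Rightarrow> real) \<Rightarrow> real" where
  "dist_mean H = (LINT x|interval_measure H. x)"

text \<open>For \<open>u < 0\<close> the domain of integration is empty and the value is \<open>0\<close>.\<close>

definition integrated_tail :: "(real \<Rightarrow> real) \<Rightarrow> real \<Rightarrow> real" where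
  "integrated_tail F u = inverse (dist_mean F) * (LINT t:{0..u}|lborel. 1 - F t)"

text \<open>
  The library's parameter \<open>k\<close> of \<^const>\<open>erlang_density\<close> is the shape minus one, hence
  this is the Gamma distribution with shape \<open>\<xi> \<ge> 1\<close> and rate \<open>\<xi>\<close>.
\<close>

definition erlang :: "nat \<Rightarrow> real \<Rightarrow> real" where
  "erlang \<xi> = cdf (density lborel (\<lambda>x. ennreal (erlang_density (\<xi> - 1) (real \<xi>) x)))"

text \<open>
  The point \<open>0\<close>, where \<open>u / s\<close> makes no sense, is left out of the domain of integration.
  This is the law of a product of independent variables whenever \<open>G\<close> has no atom at \<open>0\<close>,
  as for Erlang laws.
\<close>

definition mellin_conv :: "(real \<Rightarrow> real) \<Rightarrow> (real \<Rightarrow> real) \<Rightarrow> real \<Rightarrow> real" where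
  "mellin_conv H G u = (LINT s:{0<..}|interval_measure G. H (u / s))"

primrec conv_power_measure :: "real measure \<Rightarrow> nat \<Rightarrow> real measure" where
  "conv_power_measure M 0 = return borel 0"
| "conv_power_measure M (Suc n) = convolution M (conv_power_measure M n)"

definition conv_power :: "(real \<Rightarrow> real) \<Rightarrow> nat \<Rightarrow> real \<Rightarrow> real" where
  "conv_power H n = cdf (conv_power_measure (interval_measure H) n)"

text \<open>The sum over \<open>n \<ge> 1\<close> is reindexed to start at \<open>0\<close>.\<close>

definition psi :: "real \<Rightarrow> (real \<Rightarrow> real) \<Rightarrow> real \<Rightarrow> real" where
  "psi \<rho> H u = (1 - \<rho>) * (\<Sum>n. \<rho> ^ Suc n * (1 - conv_power H (Suc n) u))"

end

(*
  For measures on [0,\<infinity>), the cdf of a convolution at u is at most the product of the cdfs at u,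
  and integrating a difference of cdfs bounded by \<eta> on [0,u] against L gives at most \<eta> L(u).
  Hence, with A and B the two Mellin convolutions, telescoping A^{*n} - B^{*n} yields
  |A^{*n}(u) - B^{*n}(u)| \<le> \<eta> \<Sum>_{k<n} A(u)^k B(u)^{n-1-k}, and summing against \<rho>^n produces a Cauchy
  product of two geometric series. Finally A(u) \<le> Fhat(u/\<delta>) + G(\<delta>) by splitting
  according to whether the Erlang variable exceeds \<delta>.
*)

theory Submission
  imports Defs
begin

subsection \<open>Distributions on the half-line\<close>

lemma
  assumes "nonneg_distribution H"
  shows nonneg_distribution_mono: "x \<le> y \<Longrightarrow> H x \<le> H y"
    and nonneg_distribution_neg: "x < 0 \<Longrightarrow> H x = 0"
    and nonneg_distribution_at_bot: "(H \<longlongrightarrow> 0) at_bot"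
    and nonneg_distribution_nonneg: "0 \<le> H x"
    and nonneg_distribution_le_1: "H x \<le> 1"
    and nonneg_distribution_measurable: "H \<in> borel_measurable borel"
proof -
  have H: "mono H" "\<And>x. x < 0 \<Longrightarrow> H x = 0" "(H \<longlongrightarrow> 1) at_top"
    using assms by (auto simp: nonneg_distribution_def)
  show mono: "H x \<le> H y" if "x \<le> y" for x y using H(1) that by (rule monoD)
  show "H x = 0" if "x < 0" for x using H(2) that .
  have "eventually (\<lambda>x. H x = 0) at_bot"
    by (rule eventually_mono[OF eventually_gt_at_bot[of 0]]) (rule H(2))
  then show "(H \<longlongrightarrow> 0) at_bot" by (rule tendsto_eventually)
  show "0 \<le> H x" using mono[of "min x (-1)" x] H(2)[of "min x (-1)"] by auto
  show "H x \<le> 1"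
    by (rule tendsto_lowerbound[OF H(3)])
      (auto intro: eventually_mono[OF eventually_ge_at_top[of x]] mono)
  show "H \<in> borel_measurable borel" using H(1) by (rule borel_measurable_mono)
qed

lemma
  assumes "nonneg_distribution H"
  shows real_distribution_nonneg_distribution: "real_distribution (interval_measure H)"
    and cdf_nonneg_distribution: "cdf (interval_measure H) = H"
  using assms nonneg_distribution_at_bot[OF assms]
  by (auto intro!: real_distribution_interval_measure cdf_interval_measure
      simp: nonneg_distribution_def mono_def)

lemma (in real_distribution) nonneg_distribution_cdf:
  assumes "AE x in M. 0 \<le> x"
  shows "nonneg_distribution (cdf M)"
proof -
  have "cdf M x = 0" if "x < 0" for x
    unfolding cdf_def using assms that by (subst prob_eq_0) (auto elim!: eventually_mono)
  then show ?thesis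
    using cdf_nondecreasing cdf_is_right_cont cdf_lim_at_top_prob
    by (auto simp: nonneg_distribution_def mono_def)
qed

text \<open>\<open>H\<close> may have an atom at 0, so the null set to establish is the open
  negative half-line. It is the countable union of the rays \<open>{..- inverse (Suc n)}\<close>,
  each null because \<open>H\<close> vanishes at its endpoint.\<close>

lemma AE_nonneg_distribution:
  assumes "nonneg_distribution H"
  shows "AE x in interval_measure H. 0 \<le> x"
proof -
  interpret real_distribution "interval_measure H"
    using assms by (rule real_distribution_nonneg_distribution)
  have "AE x in interval_measure H. \<not> x \<le> - inverse (Suc n)" for n
    using cdf_nonneg_distribution[OF assms, THEN fun_cong, of "- inverse (Suc n)"]
      nonneg_distribution_neg[OF assms, of "- inverse (Suc n)"] prob_eq_0[of "{..- inverse (Suc n)}"]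
    by (auto simp: cdf_def)
  then have "AE x in interval_measure H. \<forall>n. \<not> x \<le> - inverse (Suc n)"
    by (simp add: AE_all_countable)
  then show ?thesis
  proof eventually_elim
    fix x :: real
    assume *: "\<forall>n. \<not> x \<le> - inverse (real (Suc n))"
    show "0 \<le> x"
    proof (rule ccontr)
      assume "\<not> 0 \<le> x"
      then obtain n where "inverse (real (Suc n)) < - x" using reals_Archimedean[of "-x"] by auto
      then have "x \<le> - inverse (real (Suc n))" by simp
      with * show False by blast
    qed
  qed
qed

subsection \<open>The integrated tail\<close>

text \<open>Since \<open>1 - F t\<close> is the probability of exceeding \<open>t\<close>, Tonelli
  turns the integral into the expected length of the part of \<open>{0..u}\<close> lying below
  \<open>x\<close>. As an expectation it becomes accessible to dominated convergence.\<close>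

lemma integrated_tail_eq_min:
  assumes F: "nonneg_distribution F"
  shows "integrated_tail F u = (LINT x|interval_measure F. max 0 (min x u)) / dist_mean F"
proof -
  interpret real_distribution "interval_measure F"
    using F by (rule real_distribution_nonneg_distribution)
  interpret pair_sigma_finite "interval_measure F" lborel ..
  note [measurable] = nonneg_distribution_measurable[OF F]
  \<comment> \<open>The double integral is taken over one region of pairs, which settles the joint
    measurability needed to swap the order of integration.\<close>
  let ?A = "\<lambda>x t. indicator {p. 0 \<le> snd p \<and> snd p \<le> u \<and> snd p < fst p} (x, t) :: ennreal"
  have tail: "ennreal (1 - F t) = (\<integral>\<^sup>+x. indicator {t<..} x \<partial>interval_measure F)" for t
  proof -
    have "prob {t<..} = 1 - prob {..t}"
      by (subst prob_compl[symmetric]) (auto intro!: arg_cong[where f=prob])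
    then show ?thesis
      using fun_cong[OF cdf_nonneg_distribution[OF F], of t]
      by (simp add: emeasure_eq_measure cdf_def)
  qed
  have "(\<integral>\<^sup>+t. ennreal (indicator {0..u} t * (1 - F t)) \<partial>lborel)
      = (\<integral>\<^sup>+t. (\<integral>\<^sup>+x. ?A x t \<partial>interval_measure F) \<partial>lborel)"
  proof (intro nn_integral_cong)
    fix t :: real
    show "ennreal (indicator {0..u} t * (1 - F t)) = (\<integral>\<^sup>+x. ?A x t \<partial>interval_measure F)"
    proof (cases "t \<in> {0..u}")
      case True
      then have "(\<integral>\<^sup>+x. ?A x t \<partial>interval_measure F)
          = (\<integral>\<^sup>+x. indicator {t<..} x \<partial>interval_measure F)"
        by (intro nn_integral_cong) (auto split: split_indicator)
      with True show ?thesis by (simp add: tail)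
    next
      case False
      then have "(\<integral>\<^sup>+x. ?A x t \<partial>interval_measure F) = (\<integral>\<^sup>+x. 0 \<partial>interval_measure F)"
        by (intro nn_integral_cong) (auto split: split_indicator)
      with False show ?thesis by simp
    qed
  qed
  also have "\<dots> = (\<integral>\<^sup>+x. (\<integral>\<^sup>+t. ?A x t \<partial>lborel) \<partial>interval_measure F)"
    by (rule Fubini') measurable
  also have "\<dots> = (\<integral>\<^sup>+x. ennreal (max 0 (min x u)) \<partial>interval_measure F)"
  proof (intro nn_integral_cong)
    fix x :: real
    have "(\<integral>\<^sup>+t. ?A x t \<partial>lborel) = (\<integral>\<^sup>+t. indicator (if x \<le> u then {0..<x} else {0..u}) t \<partial>lborel)"
      by (intro nn_integral_cong) (auto split: split_indicator)
    also have "\<dots> = ennreal (max 0 (min x u))"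
      by (cases "0 \<le> x"; cases "0 \<le> u") (auto simp: max_def min_def)
    finally show "(\<integral>\<^sup>+t. ?A x t \<partial>lborel) = ennreal (max 0 (min x u))" .
  qed
  finally have *: "(\<integral>\<^sup>+t. ennreal (indicator {0..u} t * (1 - F t)) \<partial>lborel)
      = (\<integral>\<^sup>+x. ennreal (max 0 (min x u)) \<partial>interval_measure F)" .
  have "(LINT t:{0..u}|lborel. 1 - F t) = (LINT x|interval_measure F. max 0 (min x u))"
    unfolding set_lebesgue_integral_def
    using nonneg_distribution_le_1[OF F]
    by (subst (1 2) integral_eq_nn_integral) (auto simp: *)
  then show ?thesis
    by (simp add: integrated_tail_def field_simps)
qed

text \<open>All limits are taken inside the expectation of \<open>max 0 (min x u)\<close>, with
  \<open>\<bar>x\<bar>\<close> as dominating function. The limit at infinity is the mean, which is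
  why the normalisation yields total mass 1.\<close>

lemma nonneg_distribution_integrated_tail:
  assumes F: "nonneg_distribution F" and int: "integrable (interval_measure F) (\<lambda>x. x)"
    and pos: "0 < dist_mean F"
  shows "nonneg_distribution (integrated_tail F)"
proof -
  interpret real_distribution "interval_measure F"
    using F by (rule real_distribution_nonneg_distribution)
  let ?I = "\<lambda>u. LINT x|interval_measure F. max 0 (min x u)"
  have eq: "integrated_tail F = (\<lambda>u. ?I u / dist_mean F)"
    using integrated_tail_eq_min[OF F] by (rule ext)
  have bound: "\<bar>max 0 (min x y)\<bar> \<le> \<bar>x\<bar>" for x y :: real
    by (simp add: max_def min_def)
  have int': "integrable (interval_measure F) (\<lambda>x. max 0 (min x u))" for u
    by (rule Bochner_Integration.integrable_bound[OF int]) auto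
  have mono: "?I x \<le> ?I y" if "x \<le> y" for x y
    using that by (intro integral_mono int') auto
  have cont: "(?I \<longlongrightarrow> ?I a) (at_right a)" for a
  \<comment> \<open>Dominated convergence is available along sequences. The value
    \<open>a + 1\<close> is an arbitrary point to the right of \<open>a\<close>.\<close>
  proof (rule tendsto_at_right_sequentially[of _ "a + 1"])
    fix S :: "nat \<Rightarrow> real" assume S: "S \<longlonglongrightarrow> a"
    show "(\<lambda>n. ?I (S n)) \<longlonglongrightarrow> ?I a"
    proof (rule integral_dominated_convergence[where w="\<lambda>x. \<bar>x\<bar>"])
      show "AE x in interval_measure F. (\<lambda>n. max 0 (min x (S n))) \<longlonglongrightarrow> max 0 (min x a)"
        by (intro AE_I2 tendsto_max tendsto_min tendsto_const S)
      show "AE x in interval_measure F. norm (max 0 (min x (S n))) \<le> \<bar>x\<bar>" for n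
        using bound by simp
    qed (simp_all add: int)
  qed simp
  have top: "(?I \<longlongrightarrow> dist_mean F) at_top"
  proof -
    have "(?I \<longlongrightarrow> (LINT x|interval_measure F. max 0 x)) at_top"
    proof (rule integral_dominated_convergence_at_top[where w="\<lambda>x. \<bar>x\<bar>"])
      show "AE x in interval_measure F. ((\<lambda>u. max 0 (min x u)) \<longlongrightarrow> max 0 x) at_top"
      proof (intro AE_I2 tendsto_eventually)
        fix x :: real
        show "\<forall>\<^sub>F u in at_top. max 0 (min x u) = max 0 x"
          by (rule eventually_mono[OF eventually_ge_at_top[of x]]) simp
      qed
      show "\<forall>\<^sub>F u in at_top. AE x in interval_measure F. norm (max 0 (min x u)) \<le> \<bar>x\<bar>"
        using bound by simp
    qed (simp_all add: int)
    also have "(LINT x|interval_measure F. max 0 x) = dist_mean F"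
      unfolding dist_mean_def using AE_nonneg_distribution[OF F]
      by (intro integral_cong_AE) auto
    finally show ?thesis .
  qed
  have "?I x = 0" if "x < 0" for x
    using that by (intro integral_eq_zero_AE) auto
  moreover have "((\<lambda>u. ?I u / dist_mean F) \<longlongrightarrow> dist_mean F / dist_mean F) at_top"
    using pos by (intro tendsto_intros top) auto
  moreover have "((\<lambda>u. ?I u / dist_mean F) \<longlongrightarrow> ?I a / dist_mean F) (at_right a)" for a
    using pos by (intro tendsto_intros cont) auto
  ultimately show ?thesis
    using pos mono
    by (auto simp: nonneg_distribution_def eq mono_def continuous_within divide_right_mono)
qed

subsection \<open>Products with an independent positive variable\<close>

text \<open>With \<open>G 0 = 0\<close> the factor \<open>s\<close> is almost surely positive, so
  omitting 0 from the integral loses no mass and the limit at infinity is 1. For the bound, split at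
  \<open>\<delta>\<close>: if \<open>s\<close> exceeds it then
  \<open>u / s \<le> u / \<delta>\<close>, otherwise estimate \<open>H\<close> by 1.\<close>

lemma nonneg_distribution_mellin_conv:
  assumes H: "nonneg_distribution H" and G: "nonneg_distribution G" and G0: "G 0 = 0"
  shows "nonneg_distribution (mellin_conv H G)"
    and "0 < u \<Longrightarrow> 0 < \<delta> \<Longrightarrow> mellin_conv H G u \<le> H (u / \<delta>) + G \<delta>"
proof -
  interpret real_distribution "interval_measure G"
    using G by (rule real_distribution_nonneg_distribution)
  note [measurable] = nonneg_distribution_measurable[OF H]
  let ?f = "\<lambda>u s. indicator {0<..} s *\<^sub>R H (u / s)"
  have eq: "mellin_conv H G = (\<lambda>u. LINT s|interval_measure G. ?f u s)"
    by (auto simp: mellin_conv_def set_lebesgue_integral_def)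
  have bound: "norm (?f u s) \<le> 1" for u s
    using nonneg_distribution_nonneg[OF H, of "u / s"] nonneg_distribution_le_1[OF H, of "u / s"]
    by (auto split: split_indicator)
  have int: "integrable (interval_measure G) (?f u)" for u
    using bound by (intro integrable_const_bound[of _ 1] AE_I2) auto
  have pos: "AE s in interval_measure G. 0 < s"
  proof -
    have "AE s in interval_measure G. s \<notin> {..0}"
      using fun_cong[OF cdf_nonneg_distribution[OF G], of 0] G0
      by (subst prob_eq_0[symmetric]) (auto simp: cdf_def)
    then show ?thesis by (auto elim: eventually_mono)
  qed
  have mono: "mellin_conv H G x \<le> mellin_conv H G y" if "x \<le> y" for x y
    unfolding eq using that
    by (intro integral_mono int)
      (auto split: split_indicator intro!: nonneg_distribution_mono[OF H] divide_right_mono)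
  have neg: "mellin_conv H G x = 0" if "x < 0" for x
    unfolding eq using that
    by (intro integral_eq_zero_AE AE_I2)
      (auto split: split_indicator intro!: nonneg_distribution_neg[OF H] divide_neg_pos)
  have cont: "(mellin_conv H G \<longlongrightarrow> mellin_conv H G a) (at_right a)" for a
    unfolding eq
  proof (rule tendsto_at_right_sequentially[of _ "a + 1"])
    fix S :: "nat \<Rightarrow> real" assume S: "S \<longlonglongrightarrow> a" "\<And>n. a < S n"
    show "(\<lambda>n. LINT s|interval_measure G. ?f (S n) s) \<longlonglongrightarrow> (LINT s|interval_measure G. ?f a s)"
    proof (intro integral_dominated_convergence[where w="\<lambda>_. 1"])
      show "AE s in interval_measure G. (\<lambda>n. ?f (S n) s) \<longlonglongrightarrow> ?f a s"
      proof (intro AE_I2)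
        fix s :: real
        show "(\<lambda>n. ?f (S n) s) \<longlonglongrightarrow> ?f a s"
        proof (cases "0 < s")
          case True
          have "(\<lambda>n. S n / s) \<longlonglongrightarrow> a / s" using True S by (intro tendsto_intros) auto
          \<comment> \<open>\<open>H\<close> is only right-continuous, so the quotients have to
            approach \<open>a / s\<close> strictly from above; this follows from
            \<open>a < S n\<close> and \<open>0 < s\<close>.\<close>
          then have "filterlim (\<lambda>n. S n / s) (at_right (a / s)) sequentially"
            using True S(2) less_imp_neq[OF S(2)]
            by (auto simp: filterlim_at intro!: always_eventually divide_strict_right_mono)
          moreover have "(H \<longlongrightarrow> H (a / s)) (at_right (a / s))"
            using H by (simp add: nonneg_distribution_def continuous_within)
          ultimately have "(\<lambda>n. H (S n / s)) \<longlonglongrightarrow> H (a / s)"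
            by (rule filterlim_compose[rotated])
          with True show ?thesis by simp
        qed simp
      qed
    qed (use bound in auto)
  qed simp
  have top: "(mellin_conv H G \<longlongrightarrow> 1) at_top"
  proof -
    have "((\<lambda>u. LINT s|interval_measure G. ?f u s) \<longlongrightarrow> (LINT s|interval_measure G. 1)) at_top"
    proof (intro integral_dominated_convergence_at_top[where w="\<lambda>_. 1"])
      show "AE s in interval_measure G. ((\<lambda>u. ?f u s) \<longlongrightarrow> 1) at_top"
        using pos
      proof eventually_elim
        case (elim s)
        have "filterlim (\<lambda>u. u * inverse s) at_top at_top"
          using elim by (intro filterlim_at_top_mult_tendsto_pos[where c="inverse s"] filterlim_ident)
            (auto intro: tendsto_intros)
        moreover have "(H \<longlongrightarrow> 1) at_top"
          using H by (simp add: nonneg_distribution_def)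
        ultimately have "((\<lambda>u. H (u * inverse s)) \<longlongrightarrow> 1) at_top"
          by (rule filterlim_compose[rotated])
        with elim show ?case by (simp add: divide_inverse)
      qed
    qed (use bound in auto)
    then show ?thesis by (simp add: eq prob_space[simplified])
  qed
  show "nonneg_distribution (mellin_conv H G)"
    using mono neg cont top by (auto simp: nonneg_distribution_def mono_def continuous_within)
  show "mellin_conv H G u \<le> H (u / \<delta>) + G \<delta>" if "0 < u" "0 < \<delta>" for u \<delta>
  proof -
    \<comment> \<open>The integrand on the right encodes both cases of the split; its indicator term
      integrates to \<open>G \<delta>\<close>.\<close>
    have "mellin_conv H G u \<le> (LINT s|interval_measure G. H (u / \<delta>) + indicator {..\<delta>} s)"
      unfolding eq
    proof (rule integral_mono[OF int])
      show "integrable (interval_measure G) (\<lambda>s. H (u / \<delta>) + indicator {..\<delta>} s)"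
        by (intro Bochner_Integration.integrable_add integrable_const) (auto simp: emeasure_eq_measure)
      show "?f u s \<le> H (u / \<delta>) + indicator {..\<delta>} s" for s
      proof (cases "\<delta> < s")
        case True
        then show ?thesis using that by (auto intro!: nonneg_distribution_mono[OF H] divide_left_mono)
      next
        case False
        then show ?thesis using bound[of s u] nonneg_distribution_nonneg[OF H, of "u / \<delta>"] by auto
      qed
    qed
    also have "\<dots> = H (u / \<delta>) + G \<delta>"
      using fun_cong[OF cdf_nonneg_distribution[OF G], of \<delta>]
      by (subst Bochner_Integration.integral_add)
        (auto simp: cdf_def emeasure_eq_measure prob_space[simplified])
    finally show ?thesis .
  qed
qed

section \<open>Erlang laws\<close>

lemma
  assumes "1 \<le> \<xi>"
  shows nonneg_distribution_erlang: "nonneg_distribution (erlang \<xi>)"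
    and erlang_0: "erlang \<xi> 0 = 0"
proof -
  let ?D = "density lborel (\<lambda>x. ennreal (erlang_density (\<xi> - 1) (real \<xi>) x))"
  interpret prob_space ?D using assms by (intro prob_space_erlang_density) simp
  interpret real_distribution ?D by unfold_locales simp
  show "erlang \<xi> 0 = 0"
    using emeasure_erlang_density[of "real \<xi>" "\<xi> - 1" 0] assms
    by (simp add: erlang_def cdf_def measure_def erlang_CDF_at0)
  show "nonneg_distribution (erlang \<xi>)"
    unfolding erlang_def
    by (rule nonneg_distribution_cdf) (auto simp: AE_density erlang_density_def)
qed

subsection \<open>Convolutions on the half-line\<close>

lemma real_distribution_convolution:
  assumes "real_distribution M" "real_distribution N"
  shows "real_distribution (convolution M N)"
proof -
  interpret M: real_distribution M by fact
  interpret N: real_distribution N by fact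
  interpret pair_prob_space M N ..
  have "prob_space (convolution M N)"
    unfolding convolution_def by (rule prob_space_distr) simp
  then show ?thesis by (simp add: real_distribution_def real_distribution_axioms_def)
qed

lemma AE_nonneg_convolution:
  assumes "real_distribution M" "real_distribution N"
    and M: "AE x in M. 0 \<le> x" and N: "AE x in N. (0::real) \<le> x"
  shows "AE x in convolution M N. 0 \<le> x"
proof -
  interpret M: real_distribution M by fact
  interpret N: real_distribution N by fact
  interpret pair_prob_space M N ..
  have "AE p in M \<Otimes>\<^sub>M N. 0 \<le> fst p + snd p"
  proof (rule AE_pair_measure)
    show "AE x in M. AE y in N. 0 \<le> fst (x, y) + snd (x, y)"
      using M
    proof eventually_elim
      case (elim x)
      show ?case using N by eventually_elim (use elim in auto)
    qed
  qed measurable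
  then show ?thesis
    unfolding convolution_def by (subst AE_distr_iff) (auto simp: case_prod_beta)
qed

text \<open>Conditioning on the summand distributed as \<open>M\<close> leaves the probability that
  the other one is at most \<open>v - x\<close>. Integrability is recorded so that differences of
  such integrals can be formed later.\<close>

lemma cdf_convolution:
  assumes "real_distribution M" "real_distribution N"
  shows "cdf (convolution M N) v = (LINT x|M. cdf N (v - x))"
    and "integrable M (\<lambda>x. cdf N (v - x))"
proof -
  interpret M: real_distribution M by fact
  interpret N: real_distribution N by fact
  have [measurable]: "cdf N \<in> borel_measurable borel"
    by (intro borel_measurable_mono monoI N.cdf_nondecreasing)
  have "emeasure (convolution M N) {..v} = (\<integral>\<^sup>+x. emeasure N {a. a + x \<in> {..v}} \<partial>M)"
    by (rule convolution_emeasure) (auto intro: M.finite_measure N.finite_measure)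
  also have "\<dots> = (\<integral>\<^sup>+x. ennreal (cdf N (v - x)) \<partial>M)"
  proof (intro nn_integral_cong)
    fix x :: real
    have "{a. a + x \<in> {..v}} = {..v - x}" by auto
    then show "emeasure N {a. a + x \<in> {..v}} = ennreal (cdf N (v - x))"
      by (simp add: cdf_def N.emeasure_eq_measure)
  qed
  finally show "cdf (convolution M N) v = (LINT x|M. cdf N (v - x))"
    by (subst integral_eq_nn_integral) (auto simp: measure_def cdf_def2[of "convolution M N"] N.cdf_nonneg)
  show "integrable M (\<lambda>x. cdf N (v - x))"
    by (rule M.integrable_const_bound[of _ 1]) (auto simp: N.cdf_nonneg N.cdf_bounded_prob)
qed

text \<open>If two nonnegative summands add up to at most \<open>v\<close>, each is at most
  \<open>v\<close>. In the integral, \<open>cdf N (v - x)\<close> vanishes for \<open>x > v\<close>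
  and is at most \<open>cdf N v\<close> for \<open>0 \<le> x\<close>.\<close>

lemma cdf_convolution_le:
  assumes M: "real_distribution M" and N: "real_distribution N"
    and M0: "AE x in M. 0 \<le> x" and N0: "AE x in N. 0 \<le> x"
  shows "cdf (convolution M N) v \<le> cdf M v * cdf N v"
proof -
  interpret M: real_distribution M by fact
  interpret N: real_distribution N by fact
  note neg = nonneg_distribution_neg[OF N.nonneg_distribution_cdf[OF N0]]
  have "(LINT x|M. cdf N (v - x)) \<le> (LINT x|M. cdf N v * indicator {..v} x)"
  proof (rule integral_mono_AE)
    show "integrable M (\<lambda>x. cdf N v * indicator {..v} x)"
      by (intro integrable_mult_right) (auto simp: M.emeasure_eq_measure)
    show "AE x in M. cdf N (v - x) \<le> cdf N v * indicator {..v} x"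
      using M0 by eventually_elim (auto split: split_indicator simp: neg N.cdf_nondecreasing)
  qed (rule cdf_convolution(2)[OF M N])
  also have "\<dots> = cdf N v * cdf M v" by (simp add: cdf_def)
  finally show ?thesis by (simp add: cdf_convolution(1)[OF M N] mult.commute)
qed

text \<open>The integrand \<open>cdf M (v - x) - cdf N (v - x)\<close> vanishes for
  \<open>x > v\<close>, and for \<open>0 \<le> x\<close> its argument is at most \<open>v\<close>,
  so \<open>le\<close> applies. Only the mass of \<open>L\<close> on \<open>{..v}\<close> is
  charged, which keeps a factor \<open>cdf L v\<close> at each telescoping step.\<close>

lemma cdf_convolution_diff_le:
  assumes L: "real_distribution L" and M: "real_distribution M" and N: "real_distribution N"
    and L0: "AE x in L. 0 \<le> x" and M0: "AE x in M. 0 \<le> x" and N0: "AE x in N. 0 \<le> x"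
    and le: "\<And>w. w \<le> v \<Longrightarrow> \<bar>cdf M w - cdf N w\<bar> \<le> c"
  shows "\<bar>cdf (convolution L M) v - cdf (convolution L N) v\<bar> \<le> c * cdf L v"
proof -
  interpret L: real_distribution L by fact
  interpret M: real_distribution M by fact
  interpret N: real_distribution N by fact
  note neg = nonneg_distribution_neg[OF N.nonneg_distribution_cdf[OF N0]]
    nonneg_distribution_neg[OF M.nonneg_distribution_cdf[OF M0]]
  have int: "integrable L (\<lambda>x. cdf M (v - x) - cdf N (v - x))"
    by (intro Bochner_Integration.integrable_diff cdf_convolution L M N)
  have "\<bar>LINT x|L. cdf M (v - x) - cdf N (v - x)\<bar> \<le> (LINT x|L. \<bar>cdf M (v - x) - cdf N (v - x)\<bar>)"
    by (rule integral_abs_bound)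
  also have "\<dots> \<le> (LINT x|L. c * indicator {..v} x)"
  proof (rule integral_mono_AE)
    show "integrable L (\<lambda>x. c * indicator {..v} x)"
      by (intro integrable_mult_right) (auto simp: L.emeasure_eq_measure)
    show "AE x in L. \<bar>cdf M (v - x) - cdf N (v - x)\<bar> \<le> c * indicator {..v} x"
      using L0 by eventually_elim (auto split: split_indicator simp: neg le)
  qed (use int in auto)
  also have "\<dots> = c * cdf L v" by (simp add: cdf_def)
  finally show ?thesis
    by (simp add: cdf_convolution(1) cdf_convolution(2) L M N)
qed

section \<open>Convolution powers\<close>

lemma
  assumes "real_distribution M" "AE x in M. 0 \<le> x"
  shows real_distribution_conv_power: "real_distribution (conv_power_measure M n)"
    and AE_nonneg_conv_power: "AE x in conv_power_measure M n. 0 \<le> x"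
proof (induction n)
  case 0
  have "prob_space (return borel (0::real))" by (rule prob_space_return) simp
  then show "real_distribution (conv_power_measure M 0)"
    by (simp add: real_distribution_def real_distribution_axioms_def)
  show "AE x in conv_power_measure M 0. 0 \<le> x" by (subst conv_power_measure.simps, subst AE_return) auto
next
  case (Suc n)
  show "real_distribution (conv_power_measure M (Suc n))"
    using assms Suc by (auto intro: real_distribution_convolution)
  show "AE x in conv_power_measure M (Suc n). 0 \<le> x"
    unfolding conv_power_measure.simps using assms Suc by (intro AE_nonneg_convolution)
qed

text \<open>Iterates the product bound for one convolution. The induction starts from the point mass
  at 0, whose cdf equals 1 at every \<open>v \<ge> 0\<close>.\<close>

lemma cdf_conv_power_le:
  assumes M: "real_distribution M" "AE x in M. 0 \<le> x" and "0 \<le> v"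
  shows "cdf (conv_power_measure M n) v \<le> cdf M v ^ n"
proof (induction n)
  case 0
  show ?case using \<open>0 \<le> v\<close> by (simp add: cdf_def measure_return)
next
  case (Suc n)
  interpret M: real_distribution M by fact
  have "cdf (conv_power_measure M (Suc n)) v \<le> cdf M v * cdf (conv_power_measure M n) v"
    using M by (auto intro: cdf_convolution_le real_distribution_conv_power AE_nonneg_conv_power)
  also have "\<dots> \<le> cdf M v * cdf M v ^ n"
    by (intro mult_left_mono Suc M.cdf_nonneg)
  finally show ?case by simp
qed

text \<open>
  Telescoping: \<open>M\<^sup>n\<^sup>+\<^sup>1 - N\<^sup>n\<^sup>+\<^sup>1 = M * (M\<^sup>n - N\<^sup>n) + (M - N) * N\<^sup>n\<close>.
\<close>

lemma cdf_conv_power_diff_le: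
  assumes M: "real_distribution M" "AE x in M. 0 \<le> x"
    and N: "real_distribution N" "AE x in N. 0 \<le> x"
    and "0 \<le> u" and le: "\<And>w. w \<le> u \<Longrightarrow> \<bar>cdf M w - cdf N w\<bar> \<le> \<eta>" and "v \<le> u"
  shows "\<bar>cdf (conv_power_measure M (Suc n)) v - cdf (conv_power_measure N (Suc n)) v\<bar>
    \<le> \<eta> * (\<Sum>k\<le>n. cdf M u ^ k * cdf N u ^ (n - k))"
  using \<open>v \<le> u\<close>
\<comment> \<open>The point \<open>v\<close> varies while the right-hand side stays at
  \<open>u\<close>: convolving with a further factor requires the induction hypothesis at all points
  below \<open>v\<close>.\<close>
proof (induction n arbitrary: v)
  case 0
  \<comment> \<open>The first power is by definition a convolution with the point mass at 0; this
    unit law, checked on cdfs, identifies it with the measure itself.\<close>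
  have "convolution K (return borel 0) = K" if "real_distribution K" for K :: "real measure"
  proof -
    interpret K: real_distribution K by fact
    have *: "real_distribution (return borel (0::real))"
      using prob_space_return[of "0::real" borel]
      by (simp add: real_distribution_def real_distribution_axioms_def)
    interpret R: real_distribution "return borel (0::real)" by fact
    show ?thesis
    proof (rule cdf_unique[OF real_distribution_convolution[OF that *] that], rule ext)
      fix x
      have "cdf (convolution K (return borel 0)) x = (LINT y|K. cdf (return borel 0) (x - y))"
        by (rule cdf_convolution[OF that *])
      also have "\<dots> = (LINT y|K. indicator {..x} y)"
        by (intro Bochner_Integration.integral_cong)
          (auto simp: cdf_def measure_return split: split_indicator)
      finally show "cdf (convolution K (return borel 0)) x = cdf K x" by (simp add: cdf_def)
    qed
  qed
  with M(1) N(1) le[OF 0] show ?case by simp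
next
  case (Suc n)
  interpret M: real_distribution M by fact
  interpret N: real_distribution N by fact
  let ?M = "conv_power_measure M (Suc n)" and ?N = "conv_power_measure N (Suc n)"
  let ?S = "\<Sum>k\<le>n. cdf M u ^ k * cdf N u ^ (n - k)"
  note rd = real_distribution_conv_power[OF M] real_distribution_conv_power[OF N]
  note ae = AE_nonneg_conv_power[OF M] AE_nonneg_conv_power[OF N]
  interpret PN: real_distribution ?N by (rule rd)
  have \<eta>: "0 \<le> \<eta>" using le[of u] by simp
  have S: "0 \<le> ?S" by (intro sum_nonneg mult_nonneg_nonneg zero_le_power M.cdf_nonneg N.cdf_nonneg)
  \<comment> \<open>First telescoping term: the common factor is \<open>M\<close>, and the powers
    differ by the induction hypothesis.\<close>
  have "\<bar>cdf (convolution M ?M) v - cdf (convolution M ?N) v\<bar> \<le> \<eta> * ?S * cdf M v"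
    using Suc by (intro cdf_convolution_diff_le M rd ae) auto
  also have "\<dots> \<le> \<eta> * ?S * cdf M u"
    using Suc \<eta> S by (intro mult_left_mono M.cdf_nondecreasing) auto
  finally have 1: "\<bar>cdf (convolution M ?M) v - cdf (convolution M ?N) v\<bar> \<le> \<eta> * (cdf M u * ?S)"
    by (simp add: ac_simps)
  \<comment> \<open>In the second telescoping term the common factor \<open>?N\<close> stands on the
    right, whereas the difference estimate expects it on the left.\<close>
  have comm: "convolution K ?N = convolution ?N K" if "real_distribution K" for K
  proof -
    interpret K: real_distribution K by fact
    show ?thesis
      by (rule convolution_commutative) (auto intro: K.finite_measure PN.finite_measure
        simp del: conv_power_measure.simps)
  qed
  have "\<bar>cdf (convolution M ?N) v - cdf (convolution N ?N) v\<bar> \<le> \<eta> * cdf ?N v"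
    unfolding comm[OF M(1)] comm[OF N(1)]
    using Suc le by (intro cdf_convolution_diff_le M N rd ae) auto
  also have "\<dots> \<le> \<eta> * cdf N u ^ Suc n"
    using cdf_conv_power_le[OF N \<open>0 \<le> u\<close>, of "Suc n"] PN.cdf_nondecreasing[OF \<open>v \<le> u\<close>] \<eta>
    by (intro mult_left_mono) (auto simp del: conv_power_measure.simps)
  finally have 2: "\<bar>cdf (convolution M ?N) v - cdf (convolution N ?N) v\<bar> \<le> \<eta> * cdf N u ^ Suc n" .
  \<comment> \<open>The summand \<open>k = 0\<close> comes from the second telescoping term; the
    remaining ones, shifted by one, come from the first.\<close>
  have "(\<Sum>k\<le>Suc n. cdf M u ^ k * cdf N u ^ (Suc n - k)) = cdf N u ^ Suc n + cdf M u * ?S"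
    by (simp add: sum.atMost_Suc_shift sum_distrib_left ac_simps del: sum.atMost_Suc)
  with 1 2 show ?case
    by (simp only: conv_power_measure.simps(2)[of _ "Suc n"] distrib_left)
qed

section \<open>Comparison of compound geometric tails\<close>

text \<open>The bounds on the convolution powers, weighted by \<open>\<rho> ^ Suc n\<close>, are up
  to the factor \<open>\<rho> * \<eta>\<close> the terms of the Cauchy product of two geometric
  series with ratios \<open>\<rho> * A u\<close> and \<open>\<rho> * B u\<close>.\<close>

lemma psi_diff_le:
  assumes A: "nonneg_distribution A" and B: "nonneg_distribution B"
    and "0 < \<rho>" "\<rho> < 1" "0 \<le> u"
    and le: "\<And>w. 0 \<le> w \<Longrightarrow> w \<le> u \<Longrightarrow> \<bar>A w - B w\<bar> \<le> \<eta>"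
  shows "\<bar>psi \<rho> A u - psi \<rho> B u\<bar> \<le> \<eta> * (1 - \<rho>) * \<rho> / ((1 - \<rho> * A u) * (1 - \<rho> * B u))"
proof -
  let ?q = "\<lambda>n. \<Sum>k\<le>n. (\<rho> * A u) ^ k * (\<rho> * B u) ^ (n - k)"
  let ?D = "\<lambda>n. \<rho> ^ Suc n * (1 - conv_power A (Suc n) u) - \<rho> ^ Suc n * (1 - conv_power B (Suc n) u)"
  have rd: "real_distribution (interval_measure H)" "AE x in interval_measure H. 0 \<le> x"
    if "nonneg_distribution H" for H
    using that by (rule real_distribution_nonneg_distribution, rule AE_nonneg_distribution)
  have summable: "summable (\<lambda>n. \<rho> ^ Suc n * (1 - conv_power H (Suc n) u))"
    if H: "nonneg_distribution H" for H
  proof (rule summable_comparison_test')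
    show "summable (\<lambda>n. \<rho> ^ Suc n)"
      using \<open>0 < \<rho>\<close> \<open>\<rho> < 1\<close> by (intro summable_geometric summable_Suc_iff[THEN iffD2]) auto
    fix n
    interpret real_distribution "conv_power_measure (interval_measure H) (Suc n)"
      using rd[OF H] by (rule real_distribution_conv_power)
    show "norm (\<rho> ^ Suc n * (1 - conv_power H (Suc n) u)) \<le> \<rho> ^ Suc n"
      using cdf_nonneg[of u] cdf_bounded_prob[of u] \<open>0 < \<rho>\<close>
      by (auto simp: conv_power_def abs_mult mult_le_cancel_left1 simp del: conv_power_measure.simps power_Suc)
  qed
  \<comment> \<open>\<open>H u\<close> may equal 1, so the strict inequality comes from
    \<open>\<rho> < 1\<close>.\<close>
  have lt: "norm (\<rho> * H u) < 1" if H: "nonneg_distribution H" for H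
  proof -
    have "\<rho> * H u \<le> \<rho> * 1" "0 \<le> \<rho> * H u"
      using nonneg_distribution_le_1[OF H] nonneg_distribution_nonneg[OF H] \<open>0 < \<rho>\<close>
      by (intro mult_left_mono mult_nonneg_nonneg; simp)+
    then show ?thesis
      unfolding real_norm_def using \<open>\<rho> < 1\<close> by linarith
  qed
  have sums: "?q sums (1 / (1 - \<rho> * A u) * (1 / (1 - \<rho> * B u)))"
  proof -
    have "summable (\<lambda>n. norm (c ^ n))" if "norm c < 1" for c :: real
      unfolding norm_power using that by (intro summable_geometric) simp
    with Cauchy_product_sums[of "(^) (\<rho> * A u)" "(^) (\<rho> * B u)"] lt[OF A] lt[OF B]
    show ?thesis by (simp add: suminf_geometric)
  qed
  \<comment> \<open>Of the \<open>n + 1\<close> factors \<open>\<rho>\<close>, one stays in front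
    and the other \<open>n\<close> are shared between the powers \<open>k\<close> and
    \<open>n - k\<close>.\<close>
  have D: "norm (?D n) \<le> \<rho> * \<eta> * ?q n" for n
  proof -
    have "\<bar>conv_power A (Suc n) u - conv_power B (Suc n) u\<bar> \<le> \<eta> * (\<Sum>k\<le>n. A u ^ k * B u ^ (n - k))"
      unfolding conv_power_def
    proof (rule cdf_conv_power_diff_le[OF rd[OF A] rd[OF B] \<open>0 \<le> u\<close>, unfolded
          cdf_nonneg_distribution[OF A] cdf_nonneg_distribution[OF B]])
      fix w assume "w \<le> u"
      then show "\<bar>A w - B w\<bar> \<le> \<eta>"
        \<comment> \<open>For \<open>w < 0\<close> both cdfs vanish, and \<open>le[of 0]\<close>
          supplies \<open>0 \<le> \<eta>\<close>.\<close>
        using le[of w] le[of 0] \<open>0 \<le> u\<close> nonneg_distribution_neg[OF A, of w] nonneg_distribution_neg[OF B, of w]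
        by (cases "w < 0") auto
    qed simp
    then have "\<rho> ^ Suc n * \<bar>conv_power A (Suc n) u - conv_power B (Suc n) u\<bar>
        \<le> \<rho> ^ Suc n * (\<eta> * (\<Sum>k\<le>n. A u ^ k * B u ^ (n - k)))"
      using \<open>0 < \<rho>\<close> by (intro mult_left_mono) auto
    also have "(\<Sum>k\<le>n. A u ^ k * B u ^ (n - k)) * \<rho> ^ n = ?q n"
      unfolding sum_distrib_right
      by (intro sum.cong) (auto simp: power_mult_distrib power_add[symmetric])
    then have "\<rho> ^ Suc n * (\<eta> * (\<Sum>k\<le>n. A u ^ k * B u ^ (n - k))) = \<rho> * \<eta> * ?q n"
      by (simp add: ac_simps)
    finally show ?thesis
      using \<open>0 < \<rho>\<close>
      by (simp add: right_diff_distrib[symmetric] abs_mult abs_minus_commute del: power_Suc)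
  qed
  have "\<bar>psi \<rho> A u - psi \<rho> B u\<bar> = (1 - \<rho>) * norm (\<Sum>n. ?D n)"
    using \<open>\<rho> < 1\<close> unfolding psi_def suminf_diff[OF summable[OF A] summable[OF B], symmetric]
    by (simp add: right_diff_distrib[symmetric] abs_mult del: power_Suc)
  also have "\<dots> \<le> (1 - \<rho>) * (\<Sum>n. \<rho> * \<eta> * ?q n)"
    using \<open>\<rho> < 1\<close>
    by (intro mult_left_mono norm_suminf_le D summable_mult sums_summable[OF sums]) simp
  also have "(\<Sum>n. \<rho> * \<eta> * ?q n) = \<rho> * \<eta> * (1 / (1 - \<rho> * A u) * (1 / (1 - \<rho> * B u)))"
    using sums_mult[OF sums] by (rule sums_unique[symmetric])
  finally show ?thesis by (simp add: ac_simps)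
qed

theorem theorem4p4:
  fixes \<rho> u \<eta> :: real and F Fhat Pi G :: "real \<Rightarrow> real"
    and P :: "real pmf" and s :: "nat \<Rightarrow> real" and \<xi> :: nat
  assumes "0 < \<rho>" "\<rho> < 1"
    and "nonneg_distribution F"
    and "integrable (interval_measure F) (\<lambda>x. x)" "0 < dist_mean F"
    and "strict_mono s" "0 < s 0" "set_pmf P \<subseteq> range s"
    and "1 \<le> \<xi>"
    and "0 < u"
  defines "Fhat \<equiv> integrated_tail F"
    and "Pi \<equiv> cdf (measure_pmf P)"
    and "G \<equiv> erlang \<xi>"
  defines "\<eta> \<equiv> (SUP x\<in>{0..u}. \<bar>mellin_conv Fhat G x - mellin_conv Pi G x\<bar>)"
  shows "\<forall>\<delta>>0. 1 - \<rho> * (Fhat (u / \<delta>) + G \<delta>) > 0 \<longrightarrow> 1 - \<rho> * (Pi (u / \<delta>) + G \<delta>) > 0 \<longrightarrow>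
    \<bar>psi \<rho> (mellin_conv Fhat G) u - psi \<rho> (mellin_conv Pi G) u\<bar>
      \<le> \<eta> * (1 - \<rho>) * \<rho> /
          ((1 - \<rho> * (Fhat (u / \<delta>) + G \<delta>)) * (1 - \<rho> * (Pi (u / \<delta>) + G \<delta>)))"
proof (intro allI impI)
  fix \<delta> :: real
  assume "0 < \<delta>" and pos: "1 - \<rho> * (Fhat (u / \<delta>) + G \<delta>) > 0" "1 - \<rho> * (Pi (u / \<delta>) + G \<delta>) > 0"
  let ?A = "mellin_conv Fhat G" and ?B = "mellin_conv Pi G"
  have Fhat: "nonneg_distribution Fhat"
    unfolding Fhat_def using assms(3-5) by (rule nonneg_distribution_integrated_tail)
  have s: "0 < s i" for i
    using \<open>0 < s 0\<close> strict_mono_less_eq[OF \<open>strict_mono s\<close>, of 0 i] by simp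
  have Pi: "nonneg_distribution Pi"
  proof -
    \<comment> \<open>\<open>measure_pmf P\<close> lives on the discrete sigma-algebra; its image on
      the Borel sets is a real distribution with the same cdf.\<close>
    interpret real_distribution "distr (measure_pmf P) borel (\<lambda>x. x)"
      by (rule prob_space.real_distribution_distr) (auto intro: measure_pmf.prob_space_axioms)
    have "nonneg_distribution (cdf (distr (measure_pmf P) borel (\<lambda>x. x)))"
      using s \<open>set_pmf P \<subseteq> range s\<close>
      by (intro nonneg_distribution_cdf) (fastforce simp: AE_distr_iff AE_measure_pmf_iff intro: less_imp_le)
    then show ?thesis by (simp add: Pi_def cdf_def measure_distr)
  qed
  have G: "nonneg_distribution G" "G 0 = 0"
    unfolding G_def using \<open>1 \<le> \<xi>\<close> by (rule nonneg_distribution_erlang, rule erlang_0)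
  note AB = nonneg_distribution_mellin_conv[OF Fhat G] nonneg_distribution_mellin_conv[OF Pi G]
  \<comment> \<open>A real supremum dominates its members only when the set is bounded above; two
    values in the unit interval differ by at most 1.\<close>
  have "\<bar>?A x - ?B x\<bar> \<le> 1" for x
    using nonneg_distribution_nonneg[OF AB(1), of x] nonneg_distribution_le_1[OF AB(1), of x]
      nonneg_distribution_nonneg[OF AB(3), of x] nonneg_distribution_le_1[OF AB(3), of x]
    by (simp add: abs_le_iff)
  then have \<eta>: "\<bar>?A x - ?B x\<bar> \<le> \<eta>" if "0 \<le> x" "x \<le> u" for x
    unfolding \<eta>_def using that by (intro cSUP_upper bdd_aboveI2[where M=1]) auto
  have "\<bar>psi \<rho> ?A u - psi \<rho> ?B u\<bar> \<le> \<eta> * (1 - \<rho>) * \<rho> / ((1 - \<rho> * ?A u) * (1 - \<rho> * ?B u))"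
    using \<open>0 < u\<close> by (intro psi_diff_le AB(1,3) \<open>0 < \<rho>\<close> \<open>\<rho> < 1\<close> \<eta>) auto
  also have "\<dots> \<le> \<eta> * (1 - \<rho>) * \<rho> /
      ((1 - \<rho> * (Fhat (u / \<delta>) + G \<delta>)) * (1 - \<rho> * (Pi (u / \<delta>) + G \<delta>)))"
  \<comment> \<open>Replacing \<open>?A u\<close> and \<open>?B u\<close> by their upper bounds
    shrinks both factors of the denominator. These bounds may exceed 1, so positivity of the smaller
    factors is taken from \<open>pos\<close>.\<close>
  proof (rule divide_left_mono)
    have le: "1 - \<rho> * (Fhat (u / \<delta>) + G \<delta>) \<le> 1 - \<rho> * ?A u" "1 - \<rho> * (Pi (u / \<delta>) + G \<delta>) \<le> 1 - \<rho> * ?B u"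
      using AB(2)[OF \<open>0 < u\<close> \<open>0 < \<delta>\<close>] AB(4)[OF \<open>0 < u\<close> \<open>0 < \<delta>\<close>] \<open>0 < \<rho>\<close> by auto
    then show "(1 - \<rho> * (Fhat (u / \<delta>) + G \<delta>)) * (1 - \<rho> * (Pi (u / \<delta>) + G \<delta>))
        \<le> (1 - \<rho> * ?A u) * (1 - \<rho> * ?B u)"
      using pos by (intro mult_mono) auto
    show "0 \<le> \<eta> * (1 - \<rho>) * \<rho>"
      using \<eta>[of 0] \<open>0 < u\<close> \<open>0 < \<rho>\<close> \<open>\<rho> < 1\<close> by simp
    show "0 < (1 - \<rho> * ?A u) * (1 - \<rho> * ?B u) * ((1 - \<rho> * (Fhat (u / \<delta>) + G \<delta>)) * (1 - \<rho> * (Pi (u / \<delta>) + G \<delta>)))"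
      using pos le by (intro mult_pos_pos) auto
  qed
  finally show "\<bar>psi \<rho> ?A u - psi \<rho> ?B u\<bar> \<le> \<eta> * (1 - \<rho>) * \<rho> /
      ((1 - \<rho> * (Fhat (u / \<delta>) + G \<delta>)) * (1 - \<rho> * (Pi (u / \<delta>) + G \<delta>)))" .
qed

end
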